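(* Let $\mathcal{R}=\{(r,t)\mid r>0,\ t\in\mathbb{R}\}$ and let $h=h(r)$, $r>0$, be any smooth positive function. Let $g_h=dr^2+\frac{1}{h^2(r)}dt^2$, let $J_h$ be the almost complex structure on $\mathcal{R}$ with $J_h\partial_r=T_h$ and $J_hT_h=-\partial_r$, where $T_h=h(r)\partial_t$, and let $\omega_h=\frac{1}{h(r)}\,dr\wedge dt$. Then $(\mathcal{R},g_h,J_h,\omega_h)$ is a Kähler manifold.
   Context: The coordinates $(r,t)$ are the standard ones on the right half plane $\mathcal{R}$. The vector fields $\partial_r$ and $T_h=h(r)\partial_t$ form an orthonormal frame for $g_h$, and $\omega_h$ is the Hermitian 2-form determined by $\omega_h(\partial_r,T_h)=1$. Kähler means that $J_h$ is integrable, $g_h$ is Hermitian with respect to $J_h$ with associated form $\omega_h(X,Y)=g_h(J_hX,Y)$, and $\omega_h$ is closed. *)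

theory Defs
  imports "HOL-Analysis.Analysis"
begin

section \<open>Smooth maps on open subsets of Euclidean spaces\<close>

text \<open>Meaningful for open \<open>S\<close> and finite-dimensional domain, where it is the usual notion of class
  \<open>C\<^sup>k\<close>: all iterated directional derivatives up to order \<open>k\<close> exist and are continuous.\<close>

fun Ck_on :: "nat \<Rightarrow> 'a::euclidean_space set \<Rightarrow> ('a \<Rightarrow> 'b::real_normed_vector) \<Rightarrow> bool" where
  "Ck_on 0 S f \<longleftrightarrow> continuous_on S f"
| "Ck_on (Suc k) S f \<longleftrightarrow>
     (\<forall>x\<in>S. f differentiable (at x)) \<and> (\<forall>v. Ck_on k S (\<lambda>x. frechet_derivative f (at x) v))"

definition smooth_on :: "'a::euclidean_space set \<Rightarrow> ('a \<Rightarrow> 'b::real_normed_vector) \<Rightarrow> bool" where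
  "smooth_on S f \<longleftrightarrow> (\<forall>k. Ck_on k S f)"

section \<open>Kaehler structures on an open subset of a Euclidean space\<close>

text \<open>The manifold is an open set \<open>M\<close> of a Euclidean space \<open>'a\<close>, so every tangent space is \<open>'a\<close>
  itself. Tensor fields are functions of a point followed by tangent vectors; smoothness of a
  tensor field means smoothness of its components, i.e. of its values on constant vector fields.\<close>

definition riemannian_metric_on :: "'a::euclidean_space set \<Rightarrow> ('a \<Rightarrow> 'a \<Rightarrow> 'a \<Rightarrow> real) \<Rightarrow> bool" where
  "riemannian_metric_on M g \<longleftrightarrow>
     (\<forall>p\<in>M. bilinear (g p) \<and> (\<forall>X Y. g p X Y = g p Y X) \<and> (\<forall>X. X \<noteq> 0 \<longrightarrow> g p X X > 0)) \<and>
     (\<forall>X Y. smooth_on M (\<lambda>p. g p X Y))"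

definition almost_complex_structure_on :: "'a::euclidean_space set \<Rightarrow> ('a \<Rightarrow> 'a \<Rightarrow> 'a) \<Rightarrow> bool" where
  "almost_complex_structure_on M J \<longleftrightarrow>
     (\<forall>p\<in>M. linear (J p) \<and> (\<forall>X. J p (J p X) = - X)) \<and>
     (\<forall>X. smooth_on M (\<lambda>p. J p X))"

definition two_form_on :: "'a::euclidean_space set \<Rightarrow> ('a \<Rightarrow> 'a \<Rightarrow> 'a \<Rightarrow> real) \<Rightarrow> bool" where
  "two_form_on M \<omega> \<longleftrightarrow>
     (\<forall>p\<in>M. bilinear (\<omega> p) \<and> (\<forall>X. \<omega> p X X = 0)) \<and>
     (\<forall>X Y. smooth_on M (\<lambda>p. \<omega> p X Y))"

text \<open>Integrability in the sense of holomorphic coordinates: around every point there is a smooth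
  chart into \<open>\<complex>\<^sup>n\<close>, with smooth inverse, that turns \<open>J\<close> into multiplication by the imaginary unit.
  Equivalently, \<open>J\<close> is induced by a holomorphic atlas. The complex dimension is the cardinality of
  the index type \<open>'n\<close>.\<close>

definition integrable_acs_on ::
    "'n::finite itself \<Rightarrow> 'a::euclidean_space set \<Rightarrow> ('a \<Rightarrow> 'a \<Rightarrow> 'a) \<Rightarrow> bool" where
  "integrable_acs_on _ M J \<longleftrightarrow>
     (\<forall>p\<in>M. \<exists>U (\<phi> :: 'a \<Rightarrow> complex ^ 'n) (\<psi> :: complex ^ 'n \<Rightarrow> 'a).
        open U \<and> p \<in> U \<and> U \<subseteq> M \<and> open (\<phi> ` U) \<and>
        smooth_on U \<phi> \<and> smooth_on (\<phi> ` U) \<psi> \<and> (\<forall>q\<in>U. \<psi> (\<phi> q) = q) \<and>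
        (\<forall>q\<in>U. \<forall>X. frechet_derivative \<phi> (at q) (J q X) = \<i> *s frechet_derivative \<phi> (at q) X))"

definition hermitian_metric_on ::
    "'a::euclidean_space set \<Rightarrow> ('a \<Rightarrow> 'a \<Rightarrow> 'a \<Rightarrow> real) \<Rightarrow> ('a \<Rightarrow> 'a \<Rightarrow> 'a) \<Rightarrow> bool" where
  "hermitian_metric_on M g J \<longleftrightarrow> (\<forall>p\<in>M. \<forall>X Y. g p (J p X) (J p Y) = g p X Y)"

text \<open>The invariant formula for the exterior derivative, evaluated on constant vector fields, whose
  brackets vanish.\<close>

definition ext_deriv2 :: "('a::euclidean_space \<Rightarrow> 'a \<Rightarrow> 'a \<Rightarrow> real) \<Rightarrow> 'a \<Rightarrow> 'a \<Rightarrow> 'a \<Rightarrow> 'a \<Rightarrow> real" where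
  "ext_deriv2 \<omega> p X Y Z =
     frechet_derivative (\<lambda>q. \<omega> q Y Z) (at p) X
     - frechet_derivative (\<lambda>q. \<omega> q X Z) (at p) Y
     + frechet_derivative (\<lambda>q. \<omega> q X Y) (at p) Z"

definition closed_two_form_on :: "'a::euclidean_space set \<Rightarrow> ('a \<Rightarrow> 'a \<Rightarrow> 'a \<Rightarrow> real) \<Rightarrow> bool" where
  "closed_two_form_on M \<omega> \<longleftrightarrow> (\<forall>p\<in>M. \<forall>X Y Z. ext_deriv2 \<omega> p X Y Z = 0)"

definition kaehler_manifold ::
    "'n::finite itself \<Rightarrow> 'a::euclidean_space set \<Rightarrow> ('a \<Rightarrow> 'a \<Rightarrow> 'a \<Rightarrow> real) \<Rightarrow>
     ('a \<Rightarrow> 'a \<Rightarrow> 'a) \<Rightarrow> ('a \<Rightarrow> 'a \<Rightarrow> 'a \<Rightarrow> real) \<Rightarrow> bool" where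
  "kaehler_manifold n M g J \<omega> \<longleftrightarrow>
     open M \<and> M \<noteq> {} \<and>
     riemannian_metric_on M g \<and>
     almost_complex_structure_on M J \<and> integrable_acs_on n M J \<and>
     hermitian_metric_on M g J \<and>
     two_form_on M \<omega> \<and> (\<forall>p\<in>M. \<forall>X Y. \<omega> p X Y = g p (J p X) Y) \<and>
     closed_two_form_on M \<omega>"

section \<open>The structures on the right half plane\<close>

definition right_half_plane :: "(real \<times> real) set" where
  "right_half_plane = {(r, t). r > 0}"

abbreviation (input) dr :: "real \<times> real \<Rightarrow> real" where "dr \<equiv> fst"
abbreviation (input) dt :: "real \<times> real \<Rightarrow> real" where "dt \<equiv> snd"

definition wedge :: "('a \<Rightarrow> real) \<Rightarrow> ('a \<Rightarrow> real) \<Rightarrow> 'a \<Rightarrow> 'a \<Rightarrow> real" where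
  "wedge \<alpha> \<beta> X Y = \<alpha> X * \<beta> Y - \<alpha> Y * \<beta> X"

definition partial_r :: "real \<times> real" where "partial_r = (1, 0)"
definition partial_t :: "real \<times> real" where "partial_t = (0, 1)"

definition T_h :: "(real \<Rightarrow> real) \<Rightarrow> real \<times> real \<Rightarrow> real \<times> real" where
  "T_h h p = h (fst p) *\<^sub>R partial_t"

definition g_h :: "(real \<Rightarrow> real) \<Rightarrow> real \<times> real \<Rightarrow> real \<times> real \<Rightarrow> real \<times> real \<Rightarrow> real" where
  "g_h h p X Y = dr X * dr Y + 1 / (h (fst p))\<^sup>2 * (dt X * dt Y)"

text \<open>The coefficients of \<open>X\<close> in the frame \<open>\<partial>\<^sub>r, T\<^sub>h\<close> are \<open>dr X\<close> and \<open>dt X / h\<close>; see \<open>J_h_unique\<close>.\<close>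

definition J_h :: "(real \<Rightarrow> real) \<Rightarrow> real \<times> real \<Rightarrow> real \<times> real \<Rightarrow> real \<times> real" where
  "J_h h p X = dr X *\<^sub>R T_h h p - (dt X / h (fst p)) *\<^sub>R partial_r"

definition \<omega>_h :: "(real \<Rightarrow> real) \<Rightarrow> real \<times> real \<Rightarrow> real \<times> real \<Rightarrow> real \<times> real \<Rightarrow> real" where
  "\<omega>_h h p X Y = 1 / h (fst p) * wedge dr dt X Y"

lemma frame_orthonormal:
  assumes "h (fst p) > 0"
  shows "g_h h p partial_r partial_r = 1" "g_h h p (T_h h p) (T_h h p) = 1" "g_h h p partial_r (T_h h p) = 0"
    and "\<omega>_h h p partial_r (T_h h p) = 1"
  using assms by (simp_all add: g_h_def \<omega>_h_def wedge_def T_h_def partial_r_def partial_t_def power2_eq_square)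

lemma J_h_unique:
  assumes "h (fst p) > 0"
  shows "J = J_h h p \<longleftrightarrow> linear J \<and> J partial_r = T_h h p \<and> J (T_h h p) = - partial_r"
proof
  assume "J = J_h h p"
  moreover have "linear (J_h h p)"
    by (rule linearI) (simp_all add: J_h_def T_h_def partial_r_def partial_t_def algebra_simps add_divide_distrib)
  ultimately show "linear J \<and> J partial_r = T_h h p \<and> J (T_h h p) = - partial_r"
    using assms by (simp add: J_h_def T_h_def partial_r_def partial_t_def)
next
  assume J: "linear J \<and> J partial_r = T_h h p \<and> J (T_h h p) = - partial_r"
  show "J = J_h h p"
  proof
    fix X
    have "X = dr X *\<^sub>R partial_r + (dt X / h (fst p)) *\<^sub>R T_h h p"
      using assms by (cases X) (simp add: T_h_def partial_r_def partial_t_def)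
    then have "J X = J (dr X *\<^sub>R partial_r + (dt X / h (fst p)) *\<^sub>R T_h h p)"
      by simp
    also have "\<dots> = dr X *\<^sub>R J partial_r + (dt X / h (fst p)) *\<^sub>R J (T_h h p)"
      using J by (simp only: linear_add linear_scale)
    also have "\<dots> = J_h h p X"
      using J by (simp add: J_h_def)
    finally show "J X = J_h h p X" .
  qed
qed

end

theory Submission imports Defs begin

text \<open>
  The algebraic conditions (the metric is positive definite and Hermitian, \<open>J\<^sub>h\<close> squares to minus
  the identity, \<open>\<omega>\<^sub>h(X,Y) = g\<^sub>h(J\<^sub>h X, Y)\<close>) are pointwise computations in the frame
  \<open>\<partial>\<^sub>r, T\<^sub>h\<close>. The form \<open>\<omega>\<^sub>h\<close> is closed because its coefficient depends on \<open>r\<close> alone, so that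
  \<open>d\<omega>\<^sub>h\<close> is a multiple of \<open>dr \<and> dr \<and> dt\<close>.

  Integrability comes from an explicit global holomorphic coordinate. If \<open>H\<close> is an antiderivative of \<open>h\<close>, then
  \<open>\<phi>(r,t) = H(r) + \<i> t\<close> satisfies \<open>d\<phi>(\<partial>\<^sub>r) = h\<close> and \<open>d\<phi>(T\<^sub>h) = \<i> h\<close>, so \<open>d\<phi>\<close> carries \<open>J\<^sub>h\<close> to
  multiplication by \<open>\<i>\<close>. Since \<open>h > 0\<close>, \<open>H\<close> is a diffeomorphism onto an open set of reals, and
  \<open>\<phi>\<close> is one onto a vertical strip, half plane or plane (\<open>integrable_J_h\<close>).

  The rest is calculus for \<open>Ck_on\<close>. The recursion in its definition differentiates \<open>f\<close> in a fixed
  direction \<open>v\<close> and asks for one derivative less, so each closure property is an induction on the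
  order whose step is the corresponding differentiation rule. The same bootstrap shows that the
  inverse \<open>G\<close> of \<open>H\<close> is smooth: \<open>G' = 1 / (h \<circ> G)\<close> has the same order of differentiability as \<open>G\<close>.
\<close>

section \<open>Calculus of smooth maps\<close>

text \<open>Since \<open>S\<close> is open, the derivatives at points of \<open>S\<close> only see the values on \<open>S\<close>. This lets a
  derivative be replaced by a formula that holds on \<open>S\<close> only.\<close>

lemma Ck_on_cong:
  assumes "open S" "\<And>x. x \<in> S \<Longrightarrow> f x = g x"
  shows "Ck_on k S f \<longleftrightarrow> Ck_on k S g"
  using assms(2)
proof (induction k arbitrary: f g)
  case 0
  then show ?case by (simp cong: continuous_on_cong)
next
  case (Suc k)
  have *: "(f has_derivative D) (at x) \<longleftrightarrow> (g has_derivative D) (at x)" if "x \<in> S" for x D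
    using has_derivative_transform_within_open[OF _ assms(1) that, of f D UNIV g]
      has_derivative_transform_within_open[OF _ assms(1) that, of g D UNIV f] Suc.prems
    by auto
  have "f differentiable (at x) \<longleftrightarrow> g differentiable (at x)" if "x \<in> S" for x
    using *[OF that] by (simp add: differentiable_def)
  moreover have "frechet_derivative f (at x) = frechet_derivative g (at x)" if "x \<in> S" for x
    using *[OF that] by (simp add: frechet_derivative_def)
  then have "Ck_on k S (\<lambda>x. frechet_derivative f (at x) v)
      \<longleftrightarrow> Ck_on k S (\<lambda>x. frechet_derivative g (at x) v)" for v
    by (intro Suc.IH) simp
  ultimately show ?case by simp
qed

text \<open>The introduction rule behind all the inductions below: any explicit formula \<open>D\<close> for the
  derivative on \<open>S\<close> may replace the Hilbert choice in \<open>frechet_derivative\<close>.\<close>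

lemma Ck_on_SucI:
  assumes "open S" "\<And>x. x \<in> S \<Longrightarrow> (f has_derivative D x) (at x)"
    and "\<And>v. Ck_on k S (\<lambda>x. D x v)"
  shows "Ck_on (Suc k) S f"
proof -
  have "Ck_on k S (\<lambda>x. frechet_derivative f (at x) v)" for v
    using assms(3)[of v]
    by (subst Ck_on_cong[OF assms(1), where g = "\<lambda>x. D x v"])
      (simp_all add: frechet_derivative_at[OF assms(2), symmetric])
  then show ?thesis
    using assms(2) by (auto simp: differentiable_def)
qed

lemma Ck_on_Suc_has_derivative:
  assumes "Ck_on (Suc k) S f" "x \<in> S"
  shows "(f has_derivative frechet_derivative f (at x)) (at x)"
  using assms frechet_derivative_works by auto

lemma Ck_on_SucD: "Ck_on (Suc k) S f \<Longrightarrow> Ck_on k S f"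
proof (induction k arbitrary: f)
  case 0
  then show ?case
    by (auto intro!: continuous_at_imp_continuous_on differentiable_imp_continuous_within)
next
  case (Suc k)
  have "Ck_on k S (\<lambda>x. frechet_derivative f (at x) v)" for v
    by (rule Suc.IH) (use Suc.prems in simp)
  then show ?case using Suc.prems by simp
qed

lemma Ck_on_const: "Ck_on k S (\<lambda>x. c)"
proof (induction k arbitrary: c)
  case (Suc k)
  then show ?case by simp
qed simp

lemma Ck_on_bounded_linear:
  assumes "open S" "bounded_linear L"
  shows "Ck_on k S L"
proof (cases k)
  case 0
  then show ?thesis using assms(2) by (simp add: linear_continuous_on)
next
  case (Suc m)
  then show ?thesis
    using Ck_on_SucI[OF assms(1), where D = "\<lambda>x. L"] bounded_linear_imp_has_derivative[OF assms(2)]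
      Ck_on_const by blast
qed

lemma Ck_on_add:
  assumes "open S" "Ck_on k S f" "Ck_on k S g"
  shows "Ck_on k S (\<lambda>x. f x + g x)"
  using assms(2,3)
proof (induction k arbitrary: f g)
  case 0
  then show ?case by (simp add: continuous_on_add)
next
  case (Suc k)
  show ?case
  proof (rule Ck_on_SucI[OF assms(1)])
    fix x assume "x \<in> S"
    then show "((\<lambda>x. f x + g x) has_derivative
        (\<lambda>v. frechet_derivative f (at x) v + frechet_derivative g (at x) v)) (at x)"
      using Suc.prems by (intro has_derivative_add Ck_on_Suc_has_derivative)
  next
    fix v
    show "Ck_on k S (\<lambda>x. frechet_derivative f (at x) v + frechet_derivative g (at x) v)"
      by (rule Suc.IH) (use Suc.prems in simp_all)
  qed
qed

lemma Ck_on_sum: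
  assumes "open S" "\<And>i. i \<in> I \<Longrightarrow> Ck_on k S (f i)"
  shows "Ck_on k S (\<lambda>x. \<Sum>i\<in>I. f i x)"
  using assms(2)
  by (induction I rule: infinite_finite_induct) (auto intro: Ck_on_const Ck_on_add[OF assms(1)])

lemma Ck_on_scaleR:
  assumes "open S" "Ck_on k S f" "Ck_on k S g"
  shows "Ck_on k S (\<lambda>x. f x *\<^sub>R g x)"
  using assms(2,3)
proof (induction k arbitrary: f g)
  case 0
  then show ?case by (simp add: continuous_on_scaleR)
next
  case (Suc k)
  show ?case
  proof (rule Ck_on_SucI[OF assms(1)])
    fix x assume "x \<in> S"
    then show "((\<lambda>x. f x *\<^sub>R g x) has_derivative
        (\<lambda>v. f x *\<^sub>R frechet_derivative g (at x) v + frechet_derivative f (at x) v *\<^sub>R g x)) (at x)"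
      using Suc.prems by (intro has_derivative_scaleR Ck_on_Suc_has_derivative)
  next
    fix v
    show "Ck_on k S (\<lambda>x. f x *\<^sub>R frechet_derivative g (at x) v + frechet_derivative f (at x) v *\<^sub>R g x)"
      using Suc.prems
      by (intro Ck_on_add[OF assms(1)] Suc.IH) (auto intro: Ck_on_SucD)
  qed
qed

lemma Ck_on_bounded_linear_compose:
  assumes "open S" "bounded_linear L" "Ck_on k S f"
  shows "Ck_on k S (\<lambda>x. L (f x))"
  using assms(3)
proof (induction k arbitrary: f)
  case 0
  then show ?case by (simp add: bounded_linear.continuous_on[OF assms(2)])
next
  case (Suc k)
  show ?case
  proof (rule Ck_on_SucI[OF assms(1)])
    fix x assume "x \<in> S"
    then show "((\<lambda>x. L (f x)) has_derivative (\<lambda>v. L (frechet_derivative f (at x) v))) (at x)"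
      using Suc.prems
      by (intro bounded_linear.has_derivative[OF assms(2)] Ck_on_Suc_has_derivative)
  next
    fix v
    show "Ck_on k S (\<lambda>x. L (frechet_derivative f (at x) v))"
      by (rule Suc.IH) (use Suc.prems in simp)
  qed
qed

text \<open>In the chain rule \<open>Dg(f x)(Df x v)\<close> the direction of differentiation of \<open>g\<close> varies with \<open>x\<close>,
  whereas \<open>Ck_on\<close> controls derivatives in fixed directions only. Expanding \<open>Df x v\<close> in the basis
  turns this into a sum of products of maps to which the induction hypothesis applies.\<close>

lemma Ck_on_compose:
  fixes f :: "'a::euclidean_space \<Rightarrow> 'b::euclidean_space"
  assumes "open S" "f ` S \<subseteq> T" "Ck_on k S f" "Ck_on k T g"
  shows "Ck_on k S (\<lambda>x. g (f x))"
  using assms(3,4)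
proof (induction k arbitrary: g)
  case 0
  then show ?case using assms(2) by (auto intro: continuous_on_compose2)
next
  case (Suc k)
  let ?Df = "\<lambda>x. frechet_derivative f (at x)" and ?Dg = "\<lambda>y. frechet_derivative g (at y)"
  show ?case
  proof (rule Ck_on_SucI[OF assms(1)])
    fix x assume x: "x \<in> S"
    have dg: "(g has_derivative ?Dg (f x)) (at (f x))"
      using x assms(2) Suc.prems(2) by (intro Ck_on_Suc_has_derivative) auto
    have "((\<lambda>x. g (f x)) has_derivative (\<lambda>v. ?Dg (f x) (?Df x v))) (at x)"
      using has_derivative_compose[OF Ck_on_Suc_has_derivative[OF Suc.prems(1) x] dg] .
    also have "(\<lambda>v. ?Dg (f x) (?Df x v)) = (\<lambda>v. \<Sum>b\<in>Basis. (?Df x v \<bullet> b) *\<^sub>R ?Dg (f x) b)"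
    proof
      fix v
      have lin: "linear (?Dg (f x))"
        using dg by (rule has_derivative_linear)
      have "?Dg (f x) (?Df x v) = ?Dg (f x) (\<Sum>b\<in>Basis. (?Df x v \<bullet> b) *\<^sub>R b)"
        by (simp add: euclidean_representation)
      also have "\<dots> = (\<Sum>b\<in>Basis. (?Df x v \<bullet> b) *\<^sub>R ?Dg (f x) b)"
        by (simp add: linear_sum[OF lin] linear_scale[OF lin])
      finally show "?Dg (f x) (?Df x v) = (\<Sum>b\<in>Basis. (?Df x v \<bullet> b) *\<^sub>R ?Dg (f x) b)" .
    qed
    finally show "((\<lambda>x. g (f x)) has_derivative
        (\<lambda>v. \<Sum>b\<in>Basis. (?Df x v \<bullet> b) *\<^sub>R ?Dg (f x) b)) (at x)" .
  next
    fix v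
    have "Ck_on k S (\<lambda>x. ?Df x v \<bullet> b)" for b
      using Suc.prems(1)
      by (intro Ck_on_bounded_linear_compose[OF assms(1) bounded_linear_inner_left]) simp
    moreover have "Ck_on k S (\<lambda>x. ?Dg (f x) b)" for b
      using Suc.prems(2)
      by (intro Suc.IH[where g = "\<lambda>y. ?Dg y b"] Ck_on_SucD[OF Suc.prems(1)]) simp
    ultimately show "Ck_on k S (\<lambda>x. \<Sum>b\<in>Basis. (?Df x v \<bullet> b) *\<^sub>R ?Dg (f x) b)"
      by (intro Ck_on_sum Ck_on_scaleR assms(1))
  qed
qed

lemma Ck_on_Suc_realI:
  fixes f :: "real \<Rightarrow> 'b::real_normed_vector"
  assumes "open S" "\<And>x. x \<in> S \<Longrightarrow> (f has_vector_derivative f' x) (at x)" "Ck_on k S f'"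
  shows "Ck_on (Suc k) S f"
proof (rule Ck_on_SucI[OF assms(1)])
  show "(f has_derivative (\<lambda>v. v *\<^sub>R f' x)) (at x)" if "x \<in> S" for x
    using assms(2)[OF that] by (simp add: has_vector_derivative_def)
  show "Ck_on k S (\<lambda>x. v *\<^sub>R f' x)" for v
    using assms(1) Ck_on_const assms(3) by (rule Ck_on_scaleR)
qed

text \<open>Induction on \<open>k\<close>: the derivative of \<open>inverse\<close> is a polynomial in \<open>inverse\<close> itself.\<close>

lemma Ck_on_inverse_real:
  fixes S :: "real set"
  assumes "open S" "0 \<notin> S"
  shows "Ck_on k S inverse"
proof (induction k)
  case 0
  then show ?case using assms(2) by (auto intro!: continuous_intros)
next
  case (Suc k)
  show ?case
  proof (rule Ck_on_Suc_realI[OF assms(1), where f' = "\<lambda>x. (-1) *\<^sub>R (inverse x *\<^sub>R inverse x)"])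
    fix x assume "x \<in> S"
    then have "x \<noteq> 0" using assms(2) by auto
    then show "(inverse has_vector_derivative (-1) *\<^sub>R (inverse x *\<^sub>R inverse x)) (at x)"
      using DERIV_inverse[of x UNIV]
      by (simp add: has_real_derivative_iff_has_vector_derivative[symmetric] numeral_2_eq_2)
  qed (intro Ck_on_scaleR assms(1) Ck_on_const Suc)
qed

lemma smooth_on_bounded_linear: "open S \<Longrightarrow> bounded_linear L \<Longrightarrow> smooth_on S L"
  by (simp add: smooth_on_def Ck_on_bounded_linear)

lemma smooth_on_imp_continuous_on: "smooth_on S f \<Longrightarrow> continuous_on S f"
  unfolding smooth_on_def by (drule spec[of _ 0]) simp

lemma smooth_on_const: "smooth_on S (\<lambda>x. c)"
  by (simp add: smooth_on_def Ck_on_const)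

lemma smooth_on_add:
  "open S \<Longrightarrow> smooth_on S f \<Longrightarrow> smooth_on S g \<Longrightarrow> smooth_on S (\<lambda>x. f x + g x)"
  by (simp add: smooth_on_def Ck_on_add)

lemma smooth_on_scaleR:
  "open S \<Longrightarrow> smooth_on S f \<Longrightarrow> smooth_on S g \<Longrightarrow> smooth_on S (\<lambda>x. f x *\<^sub>R g x)"
  by (simp add: smooth_on_def Ck_on_scaleR)

lemma smooth_on_compose:
  fixes f :: "'a::euclidean_space \<Rightarrow> 'b::euclidean_space"
  assumes "open S" "f ` S \<subseteq> T" "smooth_on S f" "smooth_on T g"
  shows "smooth_on S (\<lambda>x. g (f x))"
  unfolding smooth_on_def
proof
  fix k
  show "Ck_on k S (\<lambda>x. g (f x))"
    by (rule Ck_on_compose[OF assms(1,2)]) (use assms(3,4) in \<open>simp_all add: smooth_on_def\<close>)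
qed

lemma smooth_on_inverse:
  fixes f :: "'a::euclidean_space \<Rightarrow> real"
  assumes "open S" "smooth_on S f" "\<And>x. x \<in> S \<Longrightarrow> f x \<noteq> 0"
  shows "smooth_on S (\<lambda>x. inverse (f x))"
proof (rule smooth_on_compose[OF assms(1) _ assms(2)])
  show "f ` S \<subseteq> - {0}" using assms(3) by auto
  show "smooth_on (- {0::real}) inverse"
    unfolding smooth_on_def by (intro allI Ck_on_inverse_real) auto
qed

section \<open>Antiderivatives and their inverse functions\<close>

lemma smooth_on_antiderivative:
  fixes f :: "real \<Rightarrow> 'b::real_normed_vector"
  assumes "open S" "\<And>x. x \<in> S \<Longrightarrow> (f has_vector_derivative f' x) (at x)" "smooth_on S f'"
  shows "smooth_on S f"
  unfolding smooth_on_def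
proof
  fix k
  have "Ck_on (Suc k) S f"
    using assms by (intro Ck_on_Suc_realI[where f' = f']) (simp_all add: smooth_on_def del: Ck_on.simps)
  then show "Ck_on k S f" by (rule Ck_on_SucD)
qed

text \<open>The inverse function theorem gives \<open>G' = 1 / (h \<circ> G)\<close>. If \<open>G\<close> is of class \<open>C\<^sup>k\<close>, then so is the
  right-hand side, hence \<open>G\<close> is one order better.\<close>

lemma smooth_on_real_inverse_function:
  fixes H h :: "real \<Rightarrow> real"
  assumes S: "open S" and T: "open (H ` S)"
    and der: "\<And>x. x \<in> S \<Longrightarrow> (H has_real_derivative h x) (at x)"
    and h: "smooth_on S h" "\<And>x. x \<in> S \<Longrightarrow> h x \<noteq> 0"
    and G: "\<And>x. x \<in> S \<Longrightarrow> G (H x) = x"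
  shows "smooth_on (H ` S) G"
proof -
  have GS: "G ` H ` S \<subseteq> S" using G by auto
  have contH: "continuous_on S H"
    using der DERIV_isCont continuous_at_imp_continuous_on by blast
  have derG: "(G has_real_derivative inverse (h (G y))) (at y)" if y: "y \<in> H ` S" for y
  proof -
    obtain x where x: "x \<in> S" "y = H x" using y by blast
    have "(G has_derivative (\<lambda>v. inverse (h x) * v)) (at (H x))"
    proof (rule has_derivative_inverse_strong[OF S x(1) contH G])
      show "(H has_derivative (\<lambda>v. h x * v)) (at x)"
        using der[OF x(1)] by (simp add: has_field_derivative_def)
      show "(\<lambda>v. h x * v) \<circ> (\<lambda>v. inverse (h x) * v) = id"
        using h(2)[OF x(1)] by (auto simp: fun_eq_iff)
    qed
    then have "DERIV G (H x) :> inverse (h x)"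
      by (simp add: has_field_derivative_def)
    then show ?thesis using x G by simp
  qed
  have "Ck_on k (H ` S) G" for k
  proof (induction k)
    case 0
    then show ?case
      using derG DERIV_isCont continuous_at_imp_continuous_on by (metis Ck_on.simps(1))
  next
    case (Suc k)
    have "smooth_on S (\<lambda>x. inverse (h x))"
      using S h by (rule smooth_on_inverse)
    then have "Ck_on k (H ` S) (\<lambda>y. inverse (h (G y)))"
      using Suc by (intro Ck_on_compose[OF T GS, where g = "\<lambda>x. inverse (h x)"])
        (auto simp: smooth_on_def)
    then show ?case
      using derG by (intro Ck_on_Suc_realI[OF T])
        (auto simp: has_real_derivative_iff_has_vector_derivative)
  qed
  then show ?thesis by (simp add: smooth_on_def)
qed

text \<open>The function \<open>H\<close> is the real part of the holomorphic coordinate. It need not extend to \<open>0\<close>, as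
  \<open>h\<close> may fail to be integrable there. A positive derivative makes it strictly increasing, and a
  continuous injective map on an open subset of the line is open.\<close>

lemma positive_antiderivative_on_half_line:
  fixes h :: "real \<Rightarrow> real"
  assumes "continuous_on {0<..} h" "\<And>r. r > 0 \<Longrightarrow> h r > 0"
  obtains H where "\<And>r. r > 0 \<Longrightarrow> (H has_real_derivative h r) (at r)"
    "inj_on H {0<..}" "open (H ` {0<..})"
proof -
  have "\<exists>H. \<forall>x::real. 0 < ereal x \<longrightarrow> ereal x < \<infinity> \<longrightarrow> (H has_vector_derivative h x) (at x)"
    using assms(1) by (intro einterval_antiderivative) (auto simp: continuous_on_eq_continuous_at)
  then obtain H where H: "\<And>r. r > 0 \<Longrightarrow> (H has_real_derivative h r) (at r)"
    by (auto simp: has_real_derivative_iff_has_vector_derivative)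
  have "H a < H b" if "0 < a" "a < b" for a b
  proof (rule DERIV_pos_imp_increasing[OF that(2)])
    show "\<exists>y. DERIV H x :> y \<and> y > 0" if "a \<le> x" for x
      using H[of x] assms(2)[of x] that \<open>0 < a\<close> by auto
  qed
  then have inj: "inj_on H {0<..}"
    by (intro linorder_inj_onI') (auto dest: less_imp_neq)
  moreover have "continuous_on {0<..} H"
    using H by (auto intro!: continuous_at_imp_continuous_on DERIV_isCont)
  then have "open (H ` {0<..})"
    using inj by (intro invariance_of_domain) auto
  ultimately show thesis using H that by blast
qed

section \<open>The Kaehler structure on the half plane\<close>

lemma open_right_half_plane: "open right_half_plane"
proof -
  have "right_half_plane = {0<..} \<times> UNIV" by (auto simp: right_half_plane_def)
  then show ?thesis by (metis open_Times open_greaterThan open_UNIV)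
qed

lemma smooth_on_right_half_plane_fst:
  assumes "smooth_on {0<..} f"
  shows "smooth_on right_half_plane (\<lambda>p. f (fst p))"
proof (rule smooth_on_compose[OF open_right_half_plane _ _ assms])
  show "fst ` right_half_plane \<subseteq> {0<..}" by (auto simp: right_half_plane_def)
  show "smooth_on right_half_plane fst"
    using open_right_half_plane bounded_linear_fst by (rule smooth_on_bounded_linear)
qed

text \<open>The chart is \<open>H(r) + \<i> t\<close> with \<open>H' = h\<close>: the equation \<open>d\<phi>(T\<^sub>h) = \<i> d\<phi>(\<partial>\<^sub>r)\<close> reads
  \<open>h \<partial>\<^sub>t\<phi> = \<i> \<partial>\<^sub>r\<phi>\<close>, and with the normalisation \<open>\<partial>\<^sub>t\<phi> = \<i>\<close> it becomes \<open>\<partial>\<^sub>r\<phi> = h\<close>.\<close>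

lemma integrable_J_h:
  fixes h :: "real \<Rightarrow> real"
  assumes h: "smooth_on {0<..} h" and pos: "\<And>r. r > 0 \<Longrightarrow> h r > 0"
  shows "integrable_acs_on TYPE(1) right_half_plane (J_h h)"
proof -
  let ?R = right_half_plane
  obtain H where H: "\<And>r. r > 0 \<Longrightarrow> (H has_real_derivative h r) (at r)"
    and inj: "inj_on H {0<..}" and op: "open (H ` {0<..})"
    using positive_antiderivative_on_half_line smooth_on_imp_continuous_on[OF h] pos by blast
  define G where "G = inv_into {0<..} H"
  have GH: "G (H r) = r" if "r \<in> {0<..}" for r
    unfolding G_def using inj that by (rule inv_into_f_f)
  \<comment> \<open>The real basis \<open>1, \<i>\<close> of the complex line, so that \<open>\<phi>\<close> is visibly a combination of
    smooth real functions with constant vectors.\<close>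
  define e :: "complex ^ 1" where "e = (\<chi> j. 1)"
  define ie :: "complex ^ 1" where "ie = (\<chi> j. \<i>)"
  define \<phi> where "\<phi> = (\<lambda>p::real \<times> real. H (fst p) *\<^sub>R e + snd p *\<^sub>R ie)"
  define \<psi> :: "complex ^ 1 \<Rightarrow> real \<times> real"
    where "\<psi> = (\<lambda>z. G (Re (z $ 1)) *\<^sub>R (1, 0) + Im (z $ 1) *\<^sub>R (0, 1))"
  have \<phi>1: "\<phi> p $ 1 = Complex (H (fst p)) (snd p)" for p
    by (simp add: \<phi>_def e_def ie_def complex_eq_iff)
  have bl: "bounded_linear (\<lambda>z::complex ^ 1. Re (z $ 1))" "bounded_linear (\<lambda>z::complex ^ 1. Im (z $ 1))"
    by (intro bounded_linear_compose[OF bounded_linear_Re bounded_linear_vec_nth]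
        bounded_linear_compose[OF bounded_linear_Im bounded_linear_vec_nth])+
  have image: "\<phi> ` ?R = (\<lambda>z::complex ^ 1. Re (z $ 1)) -` (H ` {0<..})"
  proof (intro equalityI subsetI)
    fix z :: "complex ^ 1" assume "z \<in> (\<lambda>z. Re (z $ 1)) -` (H ` {0<..})"
    then obtain r where r: "r > 0" "Re (z $ 1) = H r" by auto
    then have "z = \<phi> (r, Im (z $ 1))"
      by (simp add: vec_eq_iff \<phi>1 complex_eq_iff)
    then show "z \<in> \<phi> ` ?R"
      using r by (auto simp: right_half_plane_def)
  qed (auto simp: right_half_plane_def \<phi>1)
  have opim: "open (\<phi> ` ?R)"
    unfolding image using op linear_continuous_on[OF bl(1)] by (intro open_vimage)
  have "smooth_on {0<..} H"
  proof (rule smooth_on_antiderivative)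
    show "(H has_vector_derivative h r) (at r)" if "r \<in> {0<..}" for r
      using H that by (simp add: has_real_derivative_iff_has_vector_derivative)
  qed (use h in simp_all)
  then have "smooth_on ?R (\<lambda>p. H (fst p))"
    by (rule smooth_on_right_half_plane_fst)
  then have smooth\<phi>: "smooth_on ?R \<phi>"
    unfolding \<phi>_def
    by (intro smooth_on_add smooth_on_scaleR smooth_on_const open_right_half_plane
        smooth_on_bounded_linear[OF _ bounded_linear_snd])
  have "smooth_on (H ` {0<..}) G"
    using smooth_on_real_inverse_function[OF open_greaterThan op _ h _ GH] H pos
    by (metis greaterThan_iff less_irrefl)
  then have "smooth_on (\<phi> ` ?R) (\<lambda>z. G (Re (z $ 1)))"
    by (intro smooth_on_compose[OF opim _ smooth_on_bounded_linear[OF opim bl(1)]])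
      (auto simp: image)
  then have smooth\<psi>: "smooth_on (\<phi> ` ?R) \<psi>"
    unfolding \<psi>_def
    by (intro smooth_on_add smooth_on_scaleR smooth_on_const opim smooth_on_bounded_linear[OF _ bl(2)])
  have inverse: "\<psi> (\<phi> q) = q" if "q \<in> ?R" for q
    using that GH by (cases q) (auto simp: \<psi>_def \<phi>1 right_half_plane_def)
  have holomorphic: "frechet_derivative \<phi> (at q) (J_h h q X) = \<i> *s frechet_derivative \<phi> (at q) X"
    if "q \<in> ?R" for q X
  proof -
    have q: "fst q > 0" using that by (auto simp: right_half_plane_def)
    have "((\<lambda>p. H (fst p)) has_derivative (\<lambda>X. fst X * h (fst q))) (at q)"
      using has_derivative_compose[OF bounded_linear_imp_has_derivative[OF bounded_linear_fst]
          H[OF q, unfolded has_field_derivative_def]]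
      by (simp add: mult.commute)
    then have "(\<phi> has_derivative (\<lambda>X. (fst X * h (fst q)) *\<^sub>R e + snd X *\<^sub>R ie)) (at q)"
      unfolding \<phi>_def
      by (intro has_derivative_add has_derivative_scaleR_left has_derivative_snd has_derivative_ident)
    then have "frechet_derivative \<phi> (at q) = (\<lambda>X. (fst X * h (fst q)) *\<^sub>R e + snd X *\<^sub>R ie)"
      by (rule frechet_derivative_at[symmetric])
    then show ?thesis
      using pos[OF q]
      by (simp add: vec_eq_iff e_def ie_def complex_eq_iff J_h_def T_h_def partial_r_def partial_t_def)
  qed
  show ?thesis
    unfolding integrable_acs_on_def
    using open_right_half_plane opim smooth\<phi> smooth\<psi> inverse holomorphic
    by (intro ballI exI[of _ ?R] exI[of _ \<phi>] exI[of _ \<psi>]) auto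
qed

text \<open>With \<open>c\<close> the derivative of \<open>1 / h\<close>, the exterior derivative is \<open>c\<close> times the cyclic sum of
  \<open>dr X \<cdot> (dr \<and> dt)(Y, Z)\<close>, that is \<open>c dr \<and> dr \<and> dt\<close>.\<close>

lemma closed_\<omega>_h:
  fixes h :: "real \<Rightarrow> real"
  assumes h: "smooth_on {0<..} h" and pos: "\<And>r. r > 0 \<Longrightarrow> h r > 0"
  shows "closed_two_form_on right_half_plane (\<omega>_h h)"
  unfolding closed_two_form_on_def
proof (intro ballI allI)
  fix p X Y Z :: "real \<times> real"
  assume "p \<in> right_half_plane"
  then have p: "fst p > 0" by (auto simp: right_half_plane_def)
  have "Ck_on 1 {0<..} h" using h by (simp add: smooth_on_def)
  then have "h differentiable (at (fst p))" using p by simp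
  then have "(\<lambda>r. 1 / h r) differentiable (at (fst p))"
    using pos[OF p] by (intro derivative_intros) auto
  then obtain c where "((\<lambda>r. 1 / h r) has_real_derivative c) (at (fst p))"
    using real_differentiable_def by blast
  then have "((\<lambda>p. 1 / h (fst p)) has_derivative (\<lambda>V. c * fst V)) (at p)"
    using has_derivative_compose[OF bounded_linear_imp_has_derivative[OF bounded_linear_fst]]
    by (fastforce simp: has_field_derivative_def)
  then have "((\<lambda>p. \<omega>_h h p V W) has_derivative (\<lambda>U. c * fst U * wedge fst snd V W)) (at p)" for V W
    unfolding \<omega>_h_def by (rule has_derivative_mult_left)
  then have "frechet_derivative (\<lambda>p. \<omega>_h h p V W) (at p) = (\<lambda>U. c * fst U * wedge fst snd V W)" for V W
    by (metis frechet_derivative_at)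
  then show "ext_deriv2 (\<omega>_h h) p X Y Z = 0"
    by (simp add: ext_deriv2_def wedge_def algebra_simps)
qed

theorem theorem1p1:
  fixes h :: "real \<Rightarrow> real"
  assumes "smooth_on {0<..} h"
    and "\<And>r. r > 0 \<Longrightarrow> h r > 0"
  shows "kaehler_manifold TYPE(1) right_half_plane (g_h h) (J_h h) (\<omega>_h h)"
proof -
  let ?R = right_half_plane
  have pos: "h (fst p) > 0" if "p \<in> ?R" for p
    using that assms(2)[of "fst p"] by (auto simp: right_half_plane_def)
  note smooth_intros = smooth_on_add smooth_on_scaleR smooth_on_const open_right_half_plane
  have smooth_h: "smooth_on ?R (\<lambda>p. h (fst p))"
    using assms(1) by (rule smooth_on_right_half_plane_fst)
  have smooth_inv: "smooth_on ?R (\<lambda>p. inverse (h (fst p)))"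
    using pos by (intro smooth_on_inverse open_right_half_plane smooth_h) (metis less_irrefl)
  have "riemannian_metric_on ?R (g_h h)"
    unfolding riemannian_metric_on_def
  proof (intro conjI ballI allI impI)
    fix p X Y assume "p \<in> ?R"
    then have h: "h (fst p) > 0" by (rule pos)
    show "bilinear (g_h h p)"
      unfolding bilinear_def g_h_def
      by (auto intro!: linearI simp: algebra_simps add_divide_distrib)
    show "g_h h p X Y = g_h h p Y X" by (simp add: g_h_def mult.commute)
    assume "X \<noteq> 0"
    then have "fst X \<noteq> 0 \<or> snd X \<noteq> 0" by (metis prod_eq_iff fst_zero snd_zero)
    \<comment> \<open>The squared terms are the coefficients of \<open>X\<close> in the orthonormal frame.\<close>
    then have "(fst X)\<^sup>2 > 0 \<or> (snd X / h (fst p))\<^sup>2 > 0"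
      using h by auto
    then have "(fst X)\<^sup>2 + (snd X / h (fst p))\<^sup>2 > 0"
      by (metis add_pos_nonneg add_nonneg_pos zero_le_power2)
    then show "g_h h p X X > 0"
      by (simp add: g_h_def power2_eq_square)
  next
    fix X Y
    have "smooth_on ?R (\<lambda>p. fst X * fst Y
        + (snd X * snd Y) *\<^sub>R (inverse (h (fst p)) *\<^sub>R inverse (h (fst p))))"
      by (intro smooth_intros smooth_inv)
    then show "smooth_on ?R (\<lambda>p. g_h h p X Y)"
      by (simp add: g_h_def power2_eq_square divide_inverse mult.commute)
  qed
  moreover have "almost_complex_structure_on ?R (J_h h)"
    unfolding almost_complex_structure_on_def
  proof (intro conjI ballI allI)
    fix p X assume "p \<in> ?R"
    then have h: "h (fst p) > 0" by (rule pos)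
    then show "linear (J_h h p)" using J_h_unique by blast
    show "J_h h p (J_h h p X) = - X"
      using h by (simp add: J_h_def T_h_def partial_r_def partial_t_def prod_eq_iff)
  next
    fix X
    have "smooth_on ?R (\<lambda>p. fst X *\<^sub>R (h (fst p) *\<^sub>R partial_t)
        + (- snd X) *\<^sub>R (inverse (h (fst p)) *\<^sub>R partial_r))"
      by (intro smooth_intros smooth_h smooth_inv)
    then show "smooth_on ?R (\<lambda>p. J_h h p X)"
      by (simp add: J_h_def T_h_def divide_inverse)
  qed
  moreover have "hermitian_metric_on ?R (g_h h) (J_h h)"
    unfolding hermitian_metric_on_def
  proof (intro ballI allI)
    fix p X Y assume "p \<in> ?R"
    then have "h (fst p) > 0" by (rule pos)
    then show "g_h h p (J_h h p X) (J_h h p Y) = g_h h p X Y"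
      by (simp add: g_h_def J_h_def T_h_def partial_r_def partial_t_def power2_eq_square)
  qed
  moreover have "two_form_on ?R (\<omega>_h h)"
    unfolding two_form_on_def
  proof (intro conjI ballI allI)
    fix p X
    show "bilinear (\<omega>_h h p)"
      unfolding bilinear_def \<omega>_h_def wedge_def
      by (auto intro!: linearI simp: algebra_simps add_divide_distrib diff_divide_distrib)
    show "\<omega>_h h p X X = 0" by (simp add: \<omega>_h_def wedge_def)
  next
    fix X Y
    have "smooth_on ?R (\<lambda>p. inverse (h (fst p)) *\<^sub>R wedge fst snd X Y)"
      by (intro smooth_intros smooth_inv)
    then show "smooth_on ?R (\<lambda>p. \<omega>_h h p X Y)"
      by (simp add: \<omega>_h_def divide_inverse)
  qed
  moreover have "\<omega>_h h p X Y = g_h h p (J_h h p X) Y" if "p \<in> ?R" for p X Y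
    using pos[OF that]
    by (simp add: \<omega>_h_def wedge_def g_h_def J_h_def T_h_def partial_r_def partial_t_def
        power2_eq_square diff_divide_distrib)
  moreover have "(1, 0) \<in> ?R" by (simp add: right_half_plane_def)
  ultimately show ?thesis
    unfolding kaehler_manifold_def
    using open_right_half_plane integrable_J_h[OF assms] closed_\<omega>_h[OF assms] by blast
qed

end
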